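(* For an arbitrary fixed order, if $OPT(I)=3$ then $FF(I)\le 6$. Together with the cases $OPT(I)\le2$, first-fit satisfies $FF(I)\le 2\,OPT(I)$ on all instances with $OPT(I)\le 3$.
   Context: Fixed order scheduling with deadlines: there are jobs $J=\{1,\dots,n\}$, each job $j$ having a processing time $p_j\in\mathbb{N}$, $p_j>0$, and a deadline $d_j\in\mathbb{N}$ with $d_j\ge p_j$ (no other assumption relating order, deadlines, or processing times). All jobs are released at time $0$; job $j$ precedes job $k$ in the fixed order iff $j<k$. A schedule $\tau:J\to\{1,\dots,n\}$ assigns jobs to identical machines; each machine processes its jobs in the fixed order from time $0$ without idle time or preemption, so job $j$ completes at $\sum_{k\le j,\tau(k)=\tau(j)}p_k$; it is feasible if every job completes by its deadline. $OPT(I)$ is the minimum number of machines used by a feasible schedule. First-fit (FF): machines indexed $1,2,\dots$; process jobs in the fixed order and assign each job $j$ to the smallest-index machine whose current load (sum of processing times already assigned) plus $p_j$ is at most $d_j$; $FF(I)$ is the number of nonempty machines. *)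

theory Defs
  imports Main
begin

text \<open>An instance: jobs 1..n, processing times p, deadlines d (functions on nat,
  only the values on 1..n matter). Job j precedes job k iff j < k.\<close>

definition valid_instance :: "nat \<Rightarrow> (nat \<Rightarrow> nat) \<Rightarrow> (nat \<Rightarrow> nat) \<Rightarrow> bool" where
  "valid_instance n p d \<longleftrightarrow> (\<forall>j\<in>{1..n}. 0 < p j \<and> p j \<le> d j)"

text \<open>Completion time of job j under schedule tau (machine processes its jobs in the
  fixed order from time 0 without idle time).\<close>
definition completion :: "(nat \<Rightarrow> nat) \<Rightarrow> (nat \<Rightarrow> nat) \<Rightarrow> nat \<Rightarrow> nat" where
  "completion p tau j = (\<Sum>k\<in>{k. 1 \<le> k \<and> k \<le> j \<and> tau k = tau j}. p k)"

definition is_schedule :: "nat \<Rightarrow> (nat \<Rightarrow> nat) \<Rightarrow> bool" where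
  "is_schedule n tau \<longleftrightarrow> (\<forall>j\<in>{1..n}. tau j \<in> {1..n})"

definition feasible :: "nat \<Rightarrow> (nat \<Rightarrow> nat) \<Rightarrow> (nat \<Rightarrow> nat) \<Rightarrow> (nat \<Rightarrow> nat) \<Rightarrow> bool" where
  "feasible n p d tau \<longleftrightarrow> is_schedule n tau \<and> (\<forall>j\<in>{1..n}. completion p tau j \<le> d j)"

definition machines_used :: "nat \<Rightarrow> (nat \<Rightarrow> nat) \<Rightarrow> nat" where
  "machines_used n tau = card (tau ` {1..n})"

definition OPT :: "nat \<Rightarrow> (nat \<Rightarrow> nat) \<Rightarrow> (nat \<Rightarrow> nat) \<Rightarrow> nat" where
  "OPT n p d = (LEAST m. \<exists>tau. feasible n p d tau \<and> machines_used n tau = m)"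

text \<open>First-fit: ff_sched p d j is the assignment after processing jobs 1..j
  (value 0 = unassigned). Job j+1 goes to the smallest machine index m \<ge> 1 whose
  current load plus p (j+1) is at most d (j+1).\<close>
definition ff_load :: "(nat \<Rightarrow> nat) \<Rightarrow> (nat \<Rightarrow> nat) \<Rightarrow> nat \<Rightarrow> nat \<Rightarrow> nat" where
  "ff_load p sigma j m = (\<Sum>k\<in>{1..j}. if sigma k = m then p k else 0)"

fun ff_sched :: "(nat \<Rightarrow> nat) \<Rightarrow> (nat \<Rightarrow> nat) \<Rightarrow> nat \<Rightarrow> (nat \<Rightarrow> nat)" where
  "ff_sched p d 0 = (\<lambda>_. 0)"
| "ff_sched p d (Suc j) =
     (let sigma = ff_sched p d j;
          m = (LEAST m. 1 \<le> m \<and> ff_load p sigma j m + p (Suc j) \<le> d (Suc j))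
      in sigma(Suc j := m))"

definition FF :: "nat \<Rightarrow> (nat \<Rightarrow> nat) \<Rightarrow> (nat \<Rightarrow> nat) \<Rightarrow> nat" where
  "FF n p d = card (ff_sched p d n ` {1..n})"

end

theory Submission
  imports Defs
begin

text \<open>
  Colour the jobs by their machine in an optimal schedule. First-fit puts a job of colour \<open>x\<close> on
  machine \<open>i\<close> only if, just before, every machine \<open>k < i\<close> carries more than the total size of the
  earlier jobs of colour \<open>x\<close>. Hence a job of colour \<open>x\<close> placed beyond machine 1 certifies
  that machines \<open>2, 3, \<dots>\<close> together carry less than the total size of the other colours.
  Applied to the last job of a suitable colour on a suitable set of machines, after which these
  machines receive jobs of the other colours only, such certificates become contradictory. For
  three colours they show that, for every colour, machine 5 or machine 6 carries at most the
  total size of that colour, so that every job fits on one of the first six machines.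
\<close>

section \<open>Total sizes of jobs by machine and by colour\<close>

text \<open>With \<open>f\<close> the first-fit assignment this is a machine load, with
  \<open>f\<close> the optimal schedule the size of a colour. Job \<open>t\<close> is excluded: this
  is the state in which first-fit places \<open>t\<close>.\<close>

definition weight :: "(nat \<Rightarrow> nat) \<Rightarrow> (nat \<Rightarrow> nat) \<Rightarrow> nat \<Rightarrow> nat \<Rightarrow> nat" where
  "weight p f x t = (\<Sum>k\<in>{1..<t}. if f k = x then p k else 0)"

lemma weight_1 [simp]: "weight p f x (Suc 0) = 0"
  by (simp add: weight_def)

lemma sum_weight_Suc:
  assumes "1 \<le> t" "finite S"
  shows "(\<Sum>x\<in>S. weight p f x (Suc t)) = (\<Sum>x\<in>S. weight p f x t) + (if f t \<in> S then p t else 0)"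
  using assms by (simp add: weight_def sum.distrib)

text \<open>A job arriving on \<open>S\<close> from time \<open>s\<close> on has a colour in
  \<open>D\<close>, so it also counts in the growth of \<open>D\<close>. The sums avoid subtraction
  on naturals; for \<open>s = 1\<close> both starting terms vanish.\<close>

lemma weight_gain:
  assumes "s \<le> t" "1 \<le> s" "finite S" "finite D"
    and "\<And>k. \<lbrakk>s \<le> k; k < t; g k \<in> S\<rbrakk> \<Longrightarrow> f k \<in> D"
  shows "(\<Sum>i\<in>S. weight p g i t) + (\<Sum>x\<in>D. weight p f x s)
       \<le> (\<Sum>i\<in>S. weight p g i s) + (\<Sum>x\<in>D. weight p f x t)"
  using assms(1,5)
proof (induction t rule: dec_induct)
  case base
  show ?case by simp
next
  case (step t)
  have "(\<Sum>i\<in>S. weight p g i t) + (\<Sum>x\<in>D. weight p f x s)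
       \<le> (\<Sum>i\<in>S. weight p g i s) + (\<Sum>x\<in>D. weight p f x t)"
    using step by simp
  moreover have "g t \<in> S \<Longrightarrow> f t \<in> D"
    using step by simp
  ultimately show ?case
    using step.hyps assms(2-4) by (auto simp: sum_weight_Suc)
qed

lemma last_job:
  fixes T :: nat
  assumes "1 \<le> k" "k < T" "Q k"
  obtains t where "1 \<le> t" "t < T" "Q t" "\<And>k. \<lbrakk>t < k; k < T\<rbrakk> \<Longrightarrow> \<not> Q k"
proof -
  define J where "J = {k\<in>{1..<T}. Q k}"
  have fin: "finite J" and "J \<noteq> {}" using assms by (auto simp: J_def)
  then have max: "Max J \<in> J" by (rule Max_in)
  show thesis
  proof (rule that)
    show "1 \<le> Max J" "Max J < T" "Q (Max J)" using max by (auto simp: J_def)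
    fix k
    assume k: "Max J < k" "k < T"
    then have "k \<notin> J" using Max_ge[OF fin, of k] by auto
    then show "\<not> Q k" using k by (simp add: J_def)
  qed
qed

section \<open>First-fit against coloured jobs\<close>

text \<open>Deadlines enter only through this inequality: \<open>t\<close> would be late on a
  skipped machine \<open>k\<close>, but is on time behind the earlier jobs of its own
  colour.\<close>

locale coloured_first_fit =
  fixes p \<tau> \<sigma> :: "nat \<Rightarrow> nat" and N :: nat
  assumes skipped: "\<lbrakk>1 \<le> t; t < N; 1 \<le> k; k < \<sigma> t\<rbrakk> \<Longrightarrow> weight p \<tau> (\<tau> t) t < weight p \<sigma> k t"
begin

abbreviation "load \<equiv> weight p \<sigma>"
abbreviation "colour \<equiv> weight p \<tau>"

text \<open>If both machines exceeded \<open>a\<close>, take the last job \<open>u\<close> of colour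
  \<open>b\<close> on them. The other machine \<open>q\<close> gains only \<open>a\<close> from then
  on, so it exceeds \<open>a\<close> already at \<open>u\<close>, while machine 1, skipped by
  \<open>u\<close>, exceeds \<open>b\<close>. Together they would carry more than all jobs before
  \<open>u\<close>.\<close>

lemma two_colours:
  assumes "a \<noteq> b" and cover: "\<And>t. \<lbrakk>1 \<le> t; t < N\<rbrakk> \<Longrightarrow> \<tau> t \<in> {a, b}" and "1 \<le> N"
  shows "\<exists>k\<in>{2, 3}. load k N \<le> colour a N"
proof (rule ccontr)
  assume "\<not> ?thesis"
  then have high: "colour a N < load 2 N" "colour a N < load 3 N" by auto
  have "\<exists>k. 1 \<le> k \<and> k < N \<and> \<tau> k = b \<and> \<sigma> k \<in> {2, 3}"
  proof (rule ccontr)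
    assume "\<not> ?thesis"
    then have "load 2 N + load 3 N \<le> colour a N"
      using weight_gain[of 1 N "{2, 3}" "{a}" \<sigma> \<tau> p] cover \<open>1 \<le> N\<close> by fastforce
    then show False using high by simp
  qed
  then obtain u where u: "1 \<le> u" "u < N" "\<tau> u = b" "\<sigma> u \<in> {2, 3}"
    and after: "\<And>k. \<lbrakk>u < k; k < N\<rbrakk> \<Longrightarrow> \<not> (\<tau> k = b \<and> \<sigma> k \<in> {2, 3})"
    using last_job[where Q = "\<lambda>k. \<tau> k = b \<and> \<sigma> k \<in> {2, 3}"] by metis
  define q where "q = 5 - \<sigma> u"
  have q: "q \<in> {2, 3}" "q \<noteq> \<sigma> u" using u(4) by (auto simp: q_def)
  have "\<tau> k = a" if "u \<le> k" "k < N" "\<sigma> k = q" for k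
    using that q u after[of k] cover[of k] by (cases "k = u") auto
  then have "load q N + colour a u \<le> load q u + colour a N"
    using weight_gain[of u N "{q}" "{a}" \<sigma> \<tau> p] u by simp
  moreover have "load 1 u + load q u \<le> colour a u + colour b u"
    using weight_gain[of 1 u "{1, q}" "{a, b}" \<sigma> \<tau> p, OF _ _ _ _ cover] u q \<open>a \<noteq> b\<close> by auto
  moreover have "colour b u < load 1 u"
    using skipped[of u 1] u by auto
  moreover have "colour a N < load q N" using high q by auto
  ultimately show False by linarith
qed

context
  fixes a b c :: nat
  assumes distinct: "a \<noteq> b" "a \<noteq> c" "b \<noteq> c"
    and cover: "\<And>t. \<lbrakk>1 \<le> t; t < N\<rbrakk> \<Longrightarrow> \<tau> t \<in> {a, b, c}"
begin

text \<open>Machine 1, skipped by \<open>t\<close>, exceeds the colour of \<open>t\<close>, which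
  leaves less than the other two colours for \<open>S\<close>.\<close>

lemma load_beyond_first:
  assumes "1 \<le> t" "t < N" "2 \<le> \<sigma> t" "finite S" "1 \<notin> S"
  shows "(\<Sum>i\<in>S. load i t) + colour (\<tau> t) t < colour a t + colour b t + colour c t"
proof -
  have "(\<Sum>i\<in>insert 1 S. load i t) \<le> (\<Sum>x\<in>{a, b, c}. colour x t)"
    using weight_gain[of 1 t "insert 1 S" "{a, b, c}" \<sigma> \<tau> p] assms cover by simp
  then show ?thesis
    using skipped[of t 1] assms distinct by simp
qed

lemma load_le_colour_beyond_four:
  assumes "1 \<le> u" "u \<le> N" and low: "\<And>k. k \<in> {1..4} \<Longrightarrow> colour c u < load k u" and q: "5 \<le> q"
  shows "load q u \<le> colour a u"
proof (rule ccontr)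
  assume "\<not> ?thesis"
  then have high: "colour a u < load q u" by simp
  let ?B = "\<lambda>k. \<tau> k = b \<and> 2 \<le> \<sigma> k"
  have "\<exists>k. 1 \<le> k \<and> k < u \<and> ?B k"
  proof (rule ccontr)
    assume none: "\<not> ?thesis"
    have "\<tau> k \<in> {a, c}" if "1 \<le> k" "k < u" "\<sigma> k \<in> {2, q}" for k
      using that none cover[of k] assms by auto
    then have "load 2 u + load q u \<le> colour a u + colour c u"
      using weight_gain[of 1 u "{2, q}" "{a, c}" \<sigma> \<tau> p] assms distinct by simp
    then show False using high low[of 2] by simp
  qed
  then obtain v where v: "1 \<le> v" "v < u" "\<tau> v = b" "2 \<le> \<sigma> v"
    and after_v: "\<And>k. \<lbrakk>v < k; k < u\<rbrakk> \<Longrightarrow> \<not> ?B k"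
    using last_job[where Q = ?B] by metis
  have no_b: "\<tau> k \<in> {a, c}" if "v \<le> k" "k < u" "2 \<le> \<sigma> k" "\<sigma> k \<noteq> \<sigma> v" for k
    using that after_v[of k] cover[of k] v assms by (cases "k = v") auto
  have v_bound: "load i v + load j v < colour a v + colour c v" if "2 \<le> i" "2 \<le> j" "i \<noteq> j" for i j
    using load_beyond_first[of v "{i, j}"] v assms that by simp
  \<comment> \<open>Otherwise \<open>q\<close> and one of machines 2, 3 gain only \<open>a\<close>
    and \<open>c\<close> from \<open>v\<close> on, so \<open>v_bound\<close> persists until
    \<open>u\<close>, against \<open>high\<close> and \<open>low\<close>.\<close>
  have "\<sigma> v = q"
  proof (rule ccontr)
    assume "\<sigma> v \<noteq> q"
    obtain i where i: "i \<in> {2, 3}" "i \<noteq> \<sigma> v" using that[of 2] that[of 3] by (cases "\<sigma> v = 2") auto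
    have "\<tau> k \<in> {a, c}" if "v \<le> k" "k < u" "\<sigma> k \<in> {i, q}" for k
      using that no_b[of k] i q \<open>\<sigma> v \<noteq> q\<close> by auto
    then have "load i u + load q u + (colour a v + colour c v)
        \<le> load i v + load q v + (colour a u + colour c u)"
      using weight_gain[of v u "{i, q}" "{a, c}" \<sigma> \<tau> p] v i q distinct by auto
    then show False using v_bound[of i q] high low[of i] i q by auto
  qed
  \<comment> \<open>Otherwise let \<open>w\<close> be the last job of colour \<open>a\<close> beyond
    machine 2. One of machines 3, 4 then gains only \<open>c\<close>, so it exceeds \<open>c\<close>
    at \<open>w\<close>, and machine 2, skipped by \<open>w\<close>, exceeds \<open>a\<close>.
    Carrying \<open>v_bound\<close> from \<open>v\<close> to \<open>w\<close> rules this
    out.\<close>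
  have no_a: "\<tau> k = c" if k: "v \<le> k" "k < u" "\<sigma> k \<in> {3, 4}" for k
  proof (rule ccontr)
    assume "\<tau> k \<noteq> c"
    then have "\<tau> k = a" using no_b[of k] k q \<open>\<sigma> v = q\<close> by auto
    let ?A = "\<lambda>k. v < k \<and> \<tau> k = a \<and> 3 \<le> \<sigma> k"
    have "?A k" using k \<open>\<tau> k = a\<close> v distinct by (auto simp: le_less)
    moreover have "1 \<le> k" using k v by simp
    ultimately obtain w where "1 \<le> w" and w: "w < u" "?A w"
      and after_w: "\<And>k. \<lbrakk>w < k; k < u\<rbrakk> \<Longrightarrow> \<not> ?A k"
      using last_job[of k u ?A] k(2) by metis
    obtain i where i: "i \<in> {3, 4}" "i \<noteq> \<sigma> w" using that[of 3] that[of 4] by (cases "\<sigma> w = 3") auto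
    have "\<tau> k = c" if "w \<le> k" "k < u" "\<sigma> k = i" for k
      using that no_b[of k] after_w[of k] w i q \<open>\<sigma> v = q\<close> by (cases "k = w") auto
    then have "load i u + colour c w \<le> load i w + colour c u"
      using weight_gain[of w u "{i}" "{c}" \<sigma> \<tau> p] w \<open>1 \<le> w\<close> by simp
    moreover have "colour a w < load 2 w"
      using skipped[of w 2] w \<open>1 \<le> w\<close> assms by auto
    moreover have "\<tau> k \<in> {a, c}" if "v \<le> k" "k < w" "\<sigma> k \<in> {2, i}" for k
      using that no_b[of k] w i q \<open>\<sigma> v = q\<close> by auto
    then have "load 2 w + load i w + (colour a v + colour c v)
        \<le> load 2 v + load i v + (colour a w + colour c w)"
      using weight_gain[of v w "{2, i}" "{a, c}" \<sigma> \<tau> p] w v i distinct by auto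
    moreover have "load 2 v + load i v < colour a v + colour c v" using v_bound[of 2 i] i by auto
    moreover have "colour c u < load i u" using low[of i] i by auto
    ultimately show False by linarith
  qed
  have c_less: "colour c v < load i v" if "i \<in> {3, 4}" for i
    using weight_gain[of v u "{i}" "{c}" \<sigma> \<tau> p] no_a low[of i] v that by fastforce
  \<comment> \<open>Here \<open>5 \<le> q\<close> matters: \<open>v\<close>, lying on
    \<open>q\<close>, has skipped machines 2, 3 and 4.\<close>
  have b_less: "colour b v < load i v" if "i \<in> {2, 3, 4}" for i
    using skipped[of v i] v assms \<open>\<sigma> v = q\<close> that by auto
  let ?A = "\<lambda>k. \<tau> k = a \<and> 2 \<le> \<sigma> k"
  show False
  proof (cases "\<exists>k. 1 \<le> k \<and> k < v \<and> ?A k")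
    case False
    have "\<tau> k \<in> {b, c}" if "1 \<le> k" "k < v" "\<sigma> k \<in> {3, 4}" for k
      using that False cover[of k] v assms by auto
    then have "load 3 v + load 4 v \<le> colour b v + colour c v"
      using weight_gain[of 1 v "{3, 4}" "{b, c}" \<sigma> \<tau> p] v distinct by simp
    then show False using c_less[of 3] b_less[of 4] by simp
  next
    case True
    then obtain w where w: "1 \<le> w" "w < v" "\<tau> w = a" "2 \<le> \<sigma> w"
      and after_w: "\<And>k. \<lbrakk>w < k; k < v\<rbrakk> \<Longrightarrow> \<not> ?A k"
      using last_job[where Q = ?A] by metis
    \<comment> \<open>At time \<open>v\<close> machines 2, 3, 4 exceed \<open>b\<close>, and 3, 4
      also exceed \<open>c\<close>. As \<open>w\<close> occupies at most one of them, a pair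
      remains: \<open>i\<close> to beat \<open>c\<close> and \<open>j\<close> to beat
      \<open>b\<close>.\<close>
    obtain i j where ij: "i \<in> {3, 4}" "j \<in> {2, 3, 4}" "i \<noteq> j" "i \<noteq> \<sigma> w" "j \<noteq> \<sigma> w"
    proof (cases "\<sigma> w = 3")
      case True
      then show thesis using that[of 4 2] by simp
    next
      case False
      then show thesis using that[of 3 2] that[of 3 4] by (cases "\<sigma> w = 2") auto
    qed
    have "\<tau> k \<in> {b, c}" if "w \<le> k" "k < v" "\<sigma> k \<in> {i, j}" for k
      using that after_w[of k] cover[of k] w v ij assms by (cases "k = w") auto
    then have "load i v + load j v + (colour b w + colour c w)
        \<le> load i w + load j w + (colour b v + colour c v)"
      using weight_gain[of w v "{i, j}" "{b, c}" \<sigma> \<tau> p] w ij distinct by simp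
    moreover have "load i w + load j w < colour b w + colour c w"
      using load_beyond_first[of w "{i, j}"] w v assms ij by auto
    ultimately show False using c_less[of i] b_less[of j] ij by linarith
  qed
qed

end

text \<open>As for two colours, the last job \<open>u\<close> not of colour \<open>a\<close> on
  machines 5, 6 leaves the other one above \<open>a\<close> at time \<open>u\<close>. Machines 1 to
  4, skipped by \<open>u\<close>, exceed the colour of \<open>u\<close>; with that colour as
  \<open>c\<close>, \<open>load_le_colour_beyond_four\<close> is contradicted.\<close>

lemma three_colours:
  assumes distinct: "a \<noteq> b" "a \<noteq> c" "b \<noteq> c"
    and cover: "\<And>t. \<lbrakk>1 \<le> t; t < N\<rbrakk> \<Longrightarrow> \<tau> t \<in> {a, b, c}" and "1 \<le> N"
  shows "\<exists>k\<in>{5, 6}. load k N \<le> colour a N"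
proof (rule ccontr)
  assume "\<not> ?thesis"
  then have high: "colour a N < load 5 N" "colour a N < load 6 N" by auto
  let ?Q = "\<lambda>k. \<tau> k \<noteq> a \<and> \<sigma> k \<in> {5, 6}"
  have "\<exists>k. 1 \<le> k \<and> k < N \<and> ?Q k"
  proof (rule ccontr)
    assume "\<not> ?thesis"
    then have "load 5 N + load 6 N \<le> colour a N"
      using weight_gain[of 1 N "{5, 6}" "{a}" \<sigma> \<tau> p] \<open>1 \<le> N\<close> by fastforce
    then show False using high by simp
  qed
  then obtain u where u: "1 \<le> u" "u < N" "\<tau> u \<noteq> a" "\<sigma> u \<in> {5, 6}"
    and after: "\<And>k. \<lbrakk>u < k; k < N\<rbrakk> \<Longrightarrow> \<not> ?Q k"
    using last_job[where Q = ?Q] by metis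
  \<comment> \<open>Subtraction from 11 swaps 5 and 6.\<close>
  define q where "q = 11 - \<sigma> u"
  have q: "q \<in> {5, 6}" "q \<noteq> \<sigma> u" using u(4) by (auto simp: q_def)
  have "\<tau> k = a" if "u \<le> k" "k < N" "\<sigma> k = q" for k
    using that q u after[of k] by (cases "k = u") auto
  then have "load q N + colour a u \<le> load q u + colour a N"
    using weight_gain[of u N "{q}" "{a}" \<sigma> \<tau> p] u by simp
  then have big: "colour a u < load q u" using high q by auto
  have low: "colour (\<tau> u) u < load k u" if "k \<in> {1..4}" for k
    using skipped[of u k] u that by auto
  have "\<tau> u = b \<or> \<tau> u = c" using cover[of u] u by auto
  then show False
  proof
    assume "\<tau> u = b"
    then have "load q u \<le> colour a u"
      using load_le_colour_beyond_four[of a c b u q] distinct cover low q u by fastforce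
    then show False using big by simp
  next
    assume "\<tau> u = c"
    then have "load q u \<le> colour a u"
      using load_le_colour_beyond_four[of a b c u q] distinct cover low q u by fastforce
    then show False using big by simp
  qed
qed

end

section \<open>Schedules and first-fit in terms of weights\<close>

lemma completion_eq_weight:
  assumes "1 \<le> j"
  shows "completion p tau j = weight p tau (tau j) j + p j"
proof -
  have "{k. 1 \<le> k \<and> k \<le> j \<and> tau k = tau j} = insert j {k\<in>{1..<j}. tau k = tau j}"
    using assms by auto
  then show ?thesis
    by (simp add: completion_def weight_def sum.inter_filter[symmetric])
qed

lemma feasible_weight_le:
  assumes "feasible n p d tau" "1 \<le> j" "j \<le> n"
  shows "weight p tau (tau j) j + p j \<le> d j"
proof -
  have "completion p tau j \<le> d j" using assms by (simp add: feasible_def)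
  then show ?thesis using assms by (simp add: completion_eq_weight)
qed

lemma ff_sched_stable:
  assumes "j \<le> i"
  shows "ff_sched p d i j = ff_sched p d j j"
  using assms by (induction i rule: dec_induct) (simp_all add: Let_def)

text \<open>The shift to \<open>Suc j\<close> arises because \<open>ff_load\<close> includes job
  \<open>j\<close>, while \<open>weight\<close> stops before its time argument.\<close>

lemma ff_load_eq_weight:
  assumes "j \<le> n"
  shows "ff_load p (ff_sched p d j) j m = weight p (ff_sched p d n) m (Suc j)"
proof -
  have "ff_sched p d j k = ff_sched p d n k" if "k \<le> j" for k
    using ff_sched_stable[of k j p d] ff_sched_stable[of k n p d] that assms by simp
  then show ?thesis
    unfolding ff_load_def weight_def by (intro sum.cong) auto
qed

lemma ff_sched_eq_Least:
  assumes "1 \<le> j" "j \<le> n"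
  shows "ff_sched p d n j = (LEAST m. 1 \<le> m \<and> weight p (ff_sched p d n) m j + p j \<le> d j)"
proof -
  obtain i where i: "j = Suc i" using assms by (cases j) auto
  show ?thesis
    using assms ff_sched_stable[of j n p d] ff_load_eq_weight[of i n p d]
    by (simp add: i Let_def)
qed

lemma coloured_first_fit_ff_sched:
  assumes "feasible n p d tau" "N \<le> Suc n"
  shows "coloured_first_fit p tau (ff_sched p d n) N"
proof
  fix t k
  assume t: "1 \<le> t" "t < N" and k: "1 \<le> k" "k < ff_sched p d n t"
  have "\<not> weight p (ff_sched p d n) k t + p t \<le> d t"
    using not_less_Least k ff_sched_eq_Least[of t n p d] t assms(2) by fastforce
  moreover have "weight p tau (tau t) t + p t \<le> d t"
    using feasible_weight_le[OF assms(1)] assms(2) t by simp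
  ultimately show "weight p tau (tau t) t < weight p (ff_sched p d n) k t" by simp
qed

text \<open>A machine carrying at most the earlier jobs of the colour of \<open>N\<close> can take
  \<open>N\<close> in time, since \<open>tau\<close> is feasible; so first-fit never goes beyond
  machine \<open>m\<close>.\<close>

lemma FF_le:
  assumes "feasible n p d tau"
    and "\<And>N. \<lbrakk>1 \<le> N; N \<le> n\<rbrakk>
      \<Longrightarrow> \<exists>k\<in>{1..m}. weight p (ff_sched p d n) k N \<le> weight p tau (tau N) N"
  shows "FF n p d \<le> m"
proof -
  have "ff_sched p d n N \<in> {1..m}" if N: "1 \<le> N" "N \<le> n" for N
  proof -
    let ?P = "\<lambda>k. 1 \<le> k \<and> weight p (ff_sched p d n) k N + p N \<le> d N"
    obtain k where k: "k \<in> {1..m}" "weight p (ff_sched p d n) k N \<le> weight p tau (tau N) N"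
      using assms(2) N by blast
    have "weight p tau (tau N) N + p N \<le> d N"
      using feasible_weight_le[OF assms(1)] N by simp
    then have "?P k" using k by auto
    then have "?P (Least ?P)" "Least ?P \<le> k"
      using LeastI[of ?P k] Least_le[of ?P k] by simp_all
    then show ?thesis
      using k ff_sched_eq_Least[of N n p d] N by auto
  qed
  then have "card (ff_sched p d n ` {1..n}) \<le> card {1..m}"
    by (intro card_mono) auto
  then show ?thesis by (simp add: FF_def)
qed

lemma OPT_attained:
  assumes "valid_instance n p d"
  obtains tau where "feasible n p d tau" "card (tau ` {1..n}) = OPT n p d"
proof -
  \<comment> \<open>One machine per job is feasible, so the minimum is attained.\<close>
  have "completion p id j = p j" if "1 \<le> j" for j
  proof -
    have "{k. 1 \<le> k \<and> k \<le> j \<and> id k = id j} = {j}" using that by auto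
    then show ?thesis by (simp add: completion_def)
  qed
  then have "feasible n p d id"
    using assms by (auto simp: feasible_def is_schedule_def valid_instance_def)
  then have "\<exists>m tau. feasible n p d tau \<and> machines_used n tau = m" by blast
  from LeastI_ex[OF this] have "\<exists>tau. feasible n p d tau \<and> machines_used n tau = OPT n p d"
    unfolding OPT_def .
  then show thesis using that by (auto simp: machines_used_def)
qed

section \<open>The bound for at most three optimal machines\<close>

lemma FF_le_two_OPT:
  assumes "valid_instance n p d" "OPT n p d \<le> 3"
  shows "FF n p d \<le> 2 * OPT n p d"
proof -
  obtain tau where tau: "feasible n p d tau" and card: "card (tau ` {1..n}) = OPT n p d"
    using OPT_attained[OF assms(1)] .
  let ?s = "ff_sched p d n"
  show ?thesis
  proof (rule FF_le[OF tau])
    fix N assume N: "1 \<le> N" "N \<le> n"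
    interpret coloured_first_fit p tau ?s N
      using coloured_first_fit_ff_sched[OF tau, of N] N by simp
    let ?a = "tau N" and ?R = "tau ` {1..n} - {tau N}"
    have in_R: "tau t \<in> insert ?a ?R" if "1 \<le> t" "t < N" for t
      using that N by auto
    have cardR: "Suc (card ?R) = OPT n p d"
      using N card by (metis atLeastAtMost_iff card_Suc_Diff1 finite_atLeastAtMost finite_imageI imageI)
    \<comment> \<open>Since job \<open>N\<close> exists, the optimum is at least 1;
      \<open>?R\<close> holds the colours other than that of \<open>N\<close>.\<close>
    then consider "card ?R = 0" "OPT n p d = 1" | "card ?R = 1" "OPT n p d = 2"
      | "card ?R = 2" "OPT n p d = 3"
      using assms(2) by linarith
    then show "\<exists>k\<in>{1..2 * OPT n p d}. load k N \<le> colour ?a N"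
    proof cases
      case 1
      then have "?R = {}" by simp
      then have "tau t = ?a" if "1 \<le> t" "t < N" for t using in_R that by blast
      then have "load 1 N \<le> colour ?a N"
        using weight_gain[of 1 N "{1}" "{?a}" ?s tau p] N by simp
      then show ?thesis using 1 by auto
    next
      case 2
      then obtain b where b: "?R = {b}" by (auto simp: card_1_singleton_iff)
      then have "?a \<noteq> b" by blast
      \<comment> \<open>Three machines suffice here, although four are allowed.\<close>
      then have "\<exists>k\<in>{2, 3}. load k N \<le> colour ?a N"
        using two_colours[OF _ in_R[unfolded b]] N by simp
      then show ?thesis using 2 by auto
    next
      case 3
      then obtain b c where bc: "?R = {b, c}" "b \<noteq> c" by (auto simp: card_2_iff)
      then have "?a \<noteq> b" "?a \<noteq> c" by blast+
      then have "\<exists>k\<in>{5, 6}. load k N \<le> colour ?a N"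
        using three_colours[OF _ _ _ in_R[unfolded bc(1)]] bc(2) N by simp
      then show ?thesis using 3 by auto
    qed
  qed
qed

theorem mainTheorem9:
  fixes n :: nat and p d :: "nat \<Rightarrow> nat"
  assumes "valid_instance n p d"
  shows "(OPT n p d = 3 \<longrightarrow> FF n p d \<le> 6) \<and>
         (OPT n p d \<le> 3 \<longrightarrow> FF n p d \<le> 2 * OPT n p d)"
  using FF_le_two_OPT[OF assms] by auto

end
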